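(* Let $\alpha\in(0,1)$, let $\delta_0>0$ be the machine relative error, and let $\delta>12\delta_0$. Define $$\theta_{s,1}=\frac{2\delta_0}{(1-\alpha)\delta},\qquad \theta_{s,2}=\left(\frac{6\delta_0}{(1-\alpha)\delta}\right)^{1/2},\qquad \theta_{f,1}=\frac{4\delta_0}{\delta},\qquad \theta_{f,2}=\left(\frac{12\delta_0}{\delta}\right)^{1/2}.$$ Let $t_0<t_1<\dots<t_k$ with $k\ge 2$ be real numbers, put $\tau_j=t_j-t_{j-1}$, let $1\le j\le k-1$, and let $\vartheta_\ell>0$. Let $I_1,I_2,J_1,J_2$ be the differences defined in the context, each regarded as a subtraction $x-y$ of the two terms $x,y$ specified there. (a) For each $i\in\{1,2\}$: if $\dfrac{\tau_j}{t_k-t_{j-1}}\ge\theta_{s,i}$, then the subtraction in $I_i$ is not a $\delta$-cancellation. (b) For each $i\in\{1,2\}$: if $\vartheta_\ell\,\tau_{k-1}\ge\theta_{f,i}$, then the subtraction in $J_i$ is not a $\delta$-cancellation. Here "the subtraction $x-y$ is not a $\delta$-cancellation" means that for all floating-point approximations $\tilde x=x(1+\delta_x)$, $\tilde y=y(1+\delta_y)$ of the two terms with relative errors $|\delta_x|<\delta_0$, $|\delta_y|<\delta_0$, one has $$\left|\frac{(\tilde x-\tilde y)-(x-y)}{x-y}\right|<\delta .$$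
   Context: Definition ($\delta$-cancellation). Given two numbers $x,y$ and approximations $\tilde x,\tilde y$ of them, the subtraction $\tilde x-\tilde y$ is called a $\delta$-cancellation if $\left|\frac{(\tilde x-\tilde y)-(x-y)}{x-y}\right|\ge\delta$. Rounding model. Each of the two terms $x$, $y$ of a subtraction is stored in the machine as an approximation whose relative error is less than the machine relative error $\delta_0$. Quantities. For a mesh $t_0<t_1<\dots<t_k$ with steps $\tau_j=t_j-t_{j-1}$ and $1\le j\le k-1$: - $I_1=(t_k-t_{j-1})^{1-\alpha}-(t_k-t_j)^{1-\alpha}$, a subtraction with $x=(t_k-t_{j-1})^{1-\alpha}$ and $y=(t_k-t_j)^{1-\alpha}$. Equivalently, with $\theta=\tau_j/(t_k-t_{j-1})\in(0,1)$ and after factoring out $(t_k-t_{j-1})^{1-\alpha}$, $x=1$ and $y=(1-\theta)^{1-\alpha}$. - $I_2=(2-\alpha)\tau_j(t_k-t_{j-1})^{1-\alpha}+(t_k-t_j)^{2-\alpha}-(t_k-t_{j-1})^{2-\alpha}$, a subtraction with $x=(2-\alpha)\tau_j(t_k-t_{j-1})^{1-\alpha}+(t_k-t_j)^{2-\alpha}$ and $y=(t_k-t_{j-1})^{2-\alpha}$. Equivalently, after factoring out $(t_k-t_{j-1})^{2-\alpha}$, $x=(2-\alpha)\theta+(1-\theta)^{2-\alpha}$ and $y=1$. For a positive number $\vartheta_\ell$ (a quadrature node of a sum-of-exponentials approximation; $\ell$ is an index) and the step $\tau_{k-1}$: - $J_1=1-e^{-\vartheta_\ell\tau_{k-1}}$,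 a subtraction with $x=1$ and $y=e^{-\vartheta_\ell\tau_{k-1}}$. - $J_2=1-\vartheta_\ell\tau_{k-1}e^{-\vartheta_\ell\tau_{k-1}}-e^{-\vartheta_\ell\tau_{k-1}}$, a subtraction with $x=1$ and $y=\vartheta_\ell\tau_{k-1}e^{-\vartheta_\ell\tau_{k-1}}+e^{-\vartheta_\ell\tau_{k-1}}$. *)

theory Defs
  imports Complex_Main
begin

text \<open>The division is the total one, with value 0 for \<open>x = y\<close>, so a subtraction of two equal
  numbers never counts as a cancellation when \<open>\<delta> > 0\<close>. The notion is meant for \<open>x \<noteq> y\<close>.\<close>

definition delta_cancellation :: "real \<Rightarrow> real \<Rightarrow> real \<Rightarrow> real \<Rightarrow> real \<Rightarrow> bool" where
  "delta_cancellation \<delta> x y x' y' \<longleftrightarrow> \<bar>((x' - y') - (x - y)) / (x - y)\<bar> \<ge> \<delta>"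

definition stored_as :: "real \<Rightarrow> real \<Rightarrow> real \<Rightarrow> bool" where
  "stored_as \<delta>\<^sub>0 x x' \<longleftrightarrow> (\<exists>\<epsilon>. \<bar>\<epsilon>\<bar> < \<delta>\<^sub>0 \<and> x' = x * (1 + \<epsilon>))"

text \<open>The subtraction is determined by the ordered pair of its terms \<open>x\<close>, \<open>y\<close>, which are rounded
  independently, and not by the value \<open>x - y\<close> alone.\<close>

definition not_delta_cancellation :: "real \<Rightarrow> real \<Rightarrow> real \<Rightarrow> real \<Rightarrow> bool" where
  "not_delta_cancellation \<delta>\<^sub>0 \<delta> x y \<longleftrightarrow>
     (\<forall>x' y'. stored_as \<delta>\<^sub>0 x x' \<longrightarrow> stored_as \<delta>\<^sub>0 y y' \<longrightarrow> \<not> delta_cancellation \<delta> x y x' y')"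

definition theta_s1 :: "real \<Rightarrow> real \<Rightarrow> real \<Rightarrow> real" where
  "theta_s1 \<alpha> \<delta>\<^sub>0 \<delta> = 2 * \<delta>\<^sub>0 / ((1 - \<alpha>) * \<delta>)"

definition theta_s2 :: "real \<Rightarrow> real \<Rightarrow> real \<Rightarrow> real" where
  "theta_s2 \<alpha> \<delta>\<^sub>0 \<delta> = sqrt (6 * \<delta>\<^sub>0 / ((1 - \<alpha>) * \<delta>))"

definition theta_f1 :: "real \<Rightarrow> real \<Rightarrow> real" where
  "theta_f1 \<delta>\<^sub>0 \<delta> = 4 * \<delta>\<^sub>0 / \<delta>"

definition theta_f2 :: "real \<Rightarrow> real \<Rightarrow> real" where
  "theta_f2 \<delta>\<^sub>0 \<delta> = sqrt (12 * \<delta>\<^sub>0 / \<delta>)"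

text \<open>Meaningful only for \<open>j \<ge> 1\<close>, as \<open>j - 1\<close> is truncated.\<close>

definition step :: "(nat \<Rightarrow> real) \<Rightarrow> nat \<Rightarrow> real" where
  "step t j = t j - t (j - 1)"

end

theory Submission
  imports Defs
begin

text \<open>The rounding errors contribute at most \<open>\<delta>\<^sub>0 * (x + y)\<close> to the difference, so it suffices
  that the condition number \<open>(x + y) / \<bar>x - y\<bar>\<close> does not exceed \<open>\<delta> / \<delta>\<^sub>0\<close>. This quantity is
  invariant under scaling, and for the four differences it is bounded by the first order
  (\<open>I\<^sub>1\<close>, \<open>J\<^sub>1\<close>) or second order (\<open>I\<^sub>2\<close>, \<open>J\<^sub>2\<close>) Taylor estimates of
  \<open>(1 - u) powr b\<close> and \<open>exp\<close>.\<close>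

text \<open>Positivity of the terms turns the strict bounds on the relative errors into a total
  error strictly below \<open>\<delta>\<^sub>0 * (x + y)\<close>. Hence a non-strict hypothesis
  suffices. It also forces \<open>x \<noteq> y\<close>, so the convention for division by zero never
  intervenes.\<close>

lemma not_delta_cancellationI:
  assumes "0 < \<delta>\<^sub>0" "0 < x" "0 < y" "\<delta>\<^sub>0 * (x + y) \<le> \<delta> * \<bar>x - y\<bar>"
  shows "not_delta_cancellation \<delta>\<^sub>0 \<delta> x y"
  unfolding not_delta_cancellation_def
proof (intro allI impI)
  fix x' y' assume "stored_as \<delta>\<^sub>0 x x'" "stored_as \<delta>\<^sub>0 y y'"
  then obtain a b where ab: "\<bar>a\<bar> < \<delta>\<^sub>0" "x' = x * (1 + a)" "\<bar>b\<bar> < \<delta>\<^sub>0" "y' = y * (1 + b)"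
    unfolding stored_as_def by blast
  have "x * \<bar>a\<bar> < x * \<delta>\<^sub>0" "y * \<bar>b\<bar> < y * \<delta>\<^sub>0"
    using ab assms by simp_all
  moreover have "(x' - y') - (x - y) = x * a - y * b"
    using ab by (simp add: algebra_simps)
  moreover have "\<bar>x * a - y * b\<bar> \<le> x * \<bar>a\<bar> + y * \<bar>b\<bar>"
    using abs_triangle_ineq4[of "x * a" "y * b"] assms by (simp add: abs_mult)
  ultimately have less: "\<bar>(x' - y') - (x - y)\<bar> < \<delta> * \<bar>x - y\<bar>"
    using assms(4) by (simp add: algebra_simps)
  then have "x \<noteq> y" by auto
  with less show "\<not> delta_cancellation \<delta> x y x' y'"
    by (simp add: delta_cancellation_def abs_divide not_le pos_divide_less_eq)
qed

text \<open>The right-hand side is the tangent at 0 of a concave function. The gap between the two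
  sides vanishes at 0 and is nondecreasing, because a nonpositive power of a number in (0,1] is at
  least 1.\<close>

lemma one_minus_powr_le:
  fixes b u :: real
  assumes "0 \<le> b" "b \<le> 1" "0 \<le> u" "u < 1"
  shows "(1 - u) powr b \<le> 1 - b * u"
proof -
  have "(\<lambda>v. 1 - b * v - (1 - v) powr b) 0 \<le> (\<lambda>v. 1 - b * v - (1 - v) powr b) u"
  proof (rule DERIV_nonneg_imp_nondecreasing[OF \<open>0 \<le> u\<close>])
    fix v assume v: "0 \<le> v" "v \<le> u"
    have "((\<lambda>v. 1 - b * v - (1 - v) powr b) has_real_derivative b * ((1 - v) powr (b - 1) - 1)) (at v)"
      using v assms by (auto intro!: derivative_eq_intros simp: algebra_simps)
    moreover have "1 \<le> (1 - v) powr (b - 1)"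
      using v assms powr_mono2'[of "b - 1" "1 - v" 1] by simp
    ultimately show "\<exists>y. ((\<lambda>v. 1 - b * v - (1 - v) powr b) has_real_derivative y) (at v) \<and> 0 \<le> y"
      using assms by (intro exI conjI) (assumption, simp)
  qed
  then show ?thesis by simp
qed

text \<open>The derivative of the gap is nonnegative by the first order estimate
  \<open>one_minus_powr_le\<close>.\<close>

lemma one_minus_powr_ge:
  fixes b u :: real
  assumes "0 \<le> b" "b \<le> 1" "0 \<le> u" "u < 1"
  shows "1 - (1 + b) * u + b * u\<^sup>2 / 2 \<le> (1 - u) powr (1 + b)"
proof -
  define f where "f = (\<lambda>v. (1 - v) powr (1 + b) - 1 + (1 + b) * v - b * v\<^sup>2 / 2)"
  have "f 0 \<le> f u"
  proof (rule DERIV_nonneg_imp_nondecreasing[OF \<open>0 \<le> u\<close>])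
    fix v assume v: "0 \<le> v" "v \<le> u"
    have "(f has_real_derivative (1 + b) * (1 - (1 - v) powr b) - b * v) (at v)"
      unfolding f_def using v assms by (auto intro!: derivative_eq_intros simp: algebra_simps)
    moreover have "b * v \<le> 1 - (1 - v) powr b"
      using one_minus_powr_le[of b v] v assms by simp
    \<comment> \<open>Dropping the factor \<open>1 + b\<close> here is why the quadratic coefficient
      is \<open>b / 2\<close> and not the Taylor value \<open>b * (1 + b) / 2\<close>. The weaker
      one is enough for the constant 6 in \<open>theta_s2\<close>.\<close>
    moreover have "1 - (1 - v) powr b \<le> (1 + b) * (1 - (1 - v) powr b)"
      using powr_le1[of b "1 - v"] v assms by (intro mult_le_cancel_right1[THEN iffD2]) auto
    ultimately show "\<exists>y. (f has_real_derivative y) (at v) \<and> 0 \<le> y"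
      by (intro exI conjI) auto
  qed
  then show ?thesis by (simp add: f_def)
qed

text \<open>Covers \<open>I\<^sub>1\<close>. After factoring out \<open>c\<close>, the terms 1 and
  \<open>q\<close> have sum at most 2 and difference at least \<open>(1 - \<alpha>) * u\<close>; the
  quotient of these bounds yields the 2 in \<open>theta_s1\<close>.\<close>

lemma not_delta_cancellation_powr_diff:
  assumes "\<alpha> < 1" "0 \<le> \<alpha>" "0 < \<delta>\<^sub>0" "0 < \<delta>" "0 < T" "0 \<le> s" "s < T" "theta_s1 \<alpha> \<delta>\<^sub>0 \<delta> \<le> s / T"
  shows "not_delta_cancellation \<delta>\<^sub>0 \<delta> (T powr (1 - \<alpha>)) ((T - s) powr (1 - \<alpha>))"
proof -
  define u where "u = s / T"
  define c where "c = T powr (1 - \<alpha>)"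
  define q where "q = (1 - u) powr (1 - \<alpha>)"
  have u: "0 \<le> u" "u < 1" using assms by (auto simp: u_def)
  have "T - s = T * (1 - u)" using assms by (simp add: u_def field_simps)
  then have y: "(T - s) powr (1 - \<alpha>) = c * q"
    using assms u by (simp add: c_def q_def powr_mult)
  have pos: "0 < c" "0 < q" using assms u by (auto simp: c_def q_def)
  have q: "q \<le> 1 - (1 - \<alpha>) * u"
    unfolding q_def using assms u by (intro one_minus_powr_le) auto
  moreover have "0 \<le> (1 - \<alpha>) * u" using assms u by simp
  ultimately have q1: "q \<le> 1" by linarith
  have "2 * \<delta>\<^sub>0 \<le> \<delta> * ((1 - \<alpha>) * u)"
    using assms by (simp add: theta_s1_def u_def[symmetric] pos_divide_le_eq mult_ac)
  also have "\<dots> \<le> \<delta> * (1 - q)" using q assms by simp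
  finally have "\<delta>\<^sub>0 * (1 + q) \<le> \<delta> * (1 - q)"
    using mult_left_le[OF q1, of \<delta>\<^sub>0] assms(3)
    by (simp only: distrib_left mult_1_right) linarith
  then have "c * (\<delta>\<^sub>0 * (1 + q)) \<le> c * (\<delta> * (1 - q))" using pos by simp
  moreover have "\<bar>c - c * q\<bar> = c * (1 - q)" using pos q1 by (simp add: right_diff_distrib)
  ultimately have "\<delta>\<^sub>0 * (c + c * q) \<le> \<delta> * \<bar>c - c * q\<bar>" by (simp only:) (simp add: algebra_simps)
  then show ?thesis
    unfolding y c_def[symmetric] using assms pos
    by (intro not_delta_cancellationI) auto
qed

text \<open>Covers \<open>I\<^sub>2\<close>. After factoring out \<open>c\<close>, the terms
  \<open>p\<close> and 1 have sum at most 3 and difference at least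
  \<open>(1 - \<alpha>) * u\<^sup>2 / 2\<close>, whence the 6 under the root in
  \<open>theta_s2\<close>.\<close>

lemma not_delta_cancellation_powr_second_order:
  assumes "\<alpha> < 1" "0 \<le> \<alpha>" "0 < \<delta>\<^sub>0" "0 < \<delta>" "0 < T" "0 \<le> s" "s < T" "theta_s2 \<alpha> \<delta>\<^sub>0 \<delta> \<le> s / T"
  shows "not_delta_cancellation \<delta>\<^sub>0 \<delta>
    ((2 - \<alpha>) * s * T powr (1 - \<alpha>) + (T - s) powr (2 - \<alpha>)) (T powr (2 - \<alpha>))"
proof -
  define u where "u = s / T"
  define c where "c = T powr (2 - \<alpha>)"
  define q where "q = (1 - u) powr (2 - \<alpha>)"
  define p where "p = (2 - \<alpha>) * u + q"
  have u: "0 \<le> u" "u < 1" using assms by (auto simp: u_def)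
  have s: "s = T * u" using assms by (simp add: u_def)
  have "T - s = T * (1 - u)" by (simp add: s algebra_simps)
  then have "(T - s) powr (2 - \<alpha>) = c * q"
    using assms u by (simp add: c_def q_def powr_mult)
  moreover have "s * T powr (1 - \<alpha>) = c * u"
    using assms powr_add[of T 1 "1 - \<alpha>"] by (simp add: s c_def)
  ultimately have x: "(2 - \<alpha>) * s * T powr (1 - \<alpha>) + (T - s) powr (2 - \<alpha>) = c * p"
    by (simp add: p_def algebra_simps)
  have pos: "0 < c" "0 < q" using assms u by (auto simp: c_def q_def)
  have "1 + (1 - \<alpha>) * u\<^sup>2 / 2 \<le> p"
    using one_minus_powr_ge[of "1 - \<alpha>" u] assms u by (simp add: p_def q_def)
  moreover have "0 \<le> (1 - \<alpha>) * u\<^sup>2 / 2" using assms by simp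
  ultimately have p: "1 \<le> p" "(1 - \<alpha>) * u\<^sup>2 / 2 \<le> p - 1" by linarith+
  \<comment> \<open>Even this crude bound gives
    \<open>p \<le> 1 + (1 - \<alpha>) * u \<le> 2\<close>.\<close>
  have "q \<le> 1 - u"
    using powr_mono'[of 1 "2 - \<alpha>" "1 - u"] assms u by (simp add: q_def)
  moreover have "(1 - \<alpha>) * u \<le> 1" using assms u by (intro mult_le_one) auto
  ultimately have p2: "p + 1 \<le> 3" by (simp add: p_def algebra_simps)
  have "6 * \<delta>\<^sub>0 / ((1 - \<alpha>) * \<delta>) \<le> u\<^sup>2"
    using assms by (simp add: theta_s2_def u_def[symmetric] sqrt_le_D)
  then have "3 * \<delta>\<^sub>0 \<le> \<delta> * ((1 - \<alpha>) * u\<^sup>2 / 2)"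
    using assms by (simp add: pos_divide_le_eq mult_ac)
  also have "\<dots> \<le> \<delta> * (p - 1)" using p assms by simp
  finally have "3 * \<delta>\<^sub>0 \<le> \<delta> * (p - 1)" .
  moreover have "\<delta>\<^sub>0 * (p + 1) \<le> \<delta>\<^sub>0 * 3" using p2 assms by (intro mult_left_mono) auto
  ultimately have "\<delta>\<^sub>0 * (p + 1) \<le> \<delta> * (p - 1)" by linarith
  then have "c * (\<delta>\<^sub>0 * (p + 1)) \<le> c * (\<delta> * (p - 1))" using pos by simp
  moreover have "\<bar>c * p - c\<bar> = c * (p - 1)" using pos p by (simp add: right_diff_distrib)
  ultimately have "\<delta>\<^sub>0 * (c * p + c) \<le> \<delta> * \<bar>c * p - c\<bar>" by (simp only:) (simp add: algebra_simps)
  then show ?thesis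
    unfolding x c_def[symmetric] using assms pos p
    by (intro not_delta_cancellationI) auto
qed

text \<open>Covers \<open>J\<^sub>1\<close>. Here \<open>z\<close> is unbounded while
  \<open>1 - exp (- z)\<close> saturates, so no linear lower bound holds globally. Instead
  \<open>exp (- z) \<le> 1 / (1 + z)\<close> reduces the claim to
  \<open>\<delta>\<^sub>0 * (2 + z) \<le> \<delta> * z\<close>.\<close>

lemma not_delta_cancellation_one_minus_exp:
  assumes "0 < \<delta>\<^sub>0" "2 * \<delta>\<^sub>0 \<le> \<delta>" "theta_f1 \<delta>\<^sub>0 \<delta> \<le> z"
  shows "not_delta_cancellation \<delta>\<^sub>0 \<delta> 1 (exp (- z))"
proof -
  define e where "e = exp (- z)"
  have \<delta>: "0 < \<delta>" using assms by simp
  have z: "4 * \<delta>\<^sub>0 \<le> \<delta> * z" using assms \<delta> by (simp add: theta_f1_def pos_divide_le_eq mult_ac)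
  then have z0: "0 < z" using assms \<delta> by (smt (verit) zero_less_mult_pos)
  have "(1 + z) * e \<le> exp z * e"
    by (intro mult_right_mono exp_ge_add_one_self) (simp add: e_def)
  then have e: "(1 + z) * e \<le> 1" by (simp add: e_def exp_minus)
  have e1: "0 < e" "e < 1" using z0 by (auto simp: e_def)
  have "(\<delta> + \<delta>\<^sub>0) * ((1 + z) * e) \<le> (\<delta> + \<delta>\<^sub>0) * 1"
    using e assms by (intro mult_left_mono) auto
  also have "\<dots> \<le> (\<delta> - \<delta>\<^sub>0) * (1 + z)"
  proof -
    \<comment> \<open>Half of \<open>\<delta> * z\<close> absorbs
      \<open>2 * \<delta>\<^sub>0\<close> by the threshold, the other half absorbs
      \<open>\<delta>\<^sub>0 * z\<close> by
      \<open>2 * \<delta>\<^sub>0 \<le> \<delta>\<close>.\<close>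
    have "2 * \<delta>\<^sub>0 * z \<le> \<delta> * z" using assms z0 by (intro mult_right_mono) auto
    with z show ?thesis by (simp add: algebra_simps)
  qed
  finally have "(1 + z) * ((\<delta> + \<delta>\<^sub>0) * e) \<le> (1 + z) * (\<delta> - \<delta>\<^sub>0)" by (simp add: mult_ac)
  then have "(\<delta> + \<delta>\<^sub>0) * e \<le> \<delta> - \<delta>\<^sub>0" using z0 by simp
  then show ?thesis
    unfolding e_def[symmetric] using assms e1
    by (intro not_delta_cancellationI) (auto simp: algebra_simps)
qed

text \<open>Covers \<open>J\<^sub>2\<close>. The linear terms of \<open>1 + z\<close> and
  \<open>exp z\<close> agree, so \<open>exp\<close> is bounded below by its quadratic Taylor
  polynomial \<open>m\<close>.\<close>

lemma not_delta_cancellation_one_minus_exp_second_order: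
  assumes "0 < \<delta>\<^sub>0" "12 * \<delta>\<^sub>0 \<le> \<delta>" "theta_f2 \<delta>\<^sub>0 \<delta> \<le> z"
  shows "not_delta_cancellation \<delta>\<^sub>0 \<delta> 1 (z * exp (- z) + exp (- z))"
proof -
  define y where "y = z * exp (- z) + exp (- z)"
  define m where "m = 1 + z + z\<^sup>2 / 2"
  have \<delta>: "0 < \<delta>" using assms by simp
  have "0 < theta_f2 \<delta>\<^sub>0 \<delta>" using assms \<delta> by (simp add: theta_f2_def)
  then have z0: "0 < z" using assms by simp
  have "12 * \<delta>\<^sub>0 / \<delta> \<le> z\<^sup>2"
    using assms by (simp add: theta_f2_def sqrt_le_D)
  then have z: "12 * \<delta>\<^sub>0 \<le> \<delta> * z\<^sup>2" using \<delta> by (simp add: pos_divide_le_eq mult_ac)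
  have m0: "0 < m" "1 + z \<le> m" using z0 by (auto simp: m_def add_pos_pos)
  have y0: "0 < y" using z0 by (simp add: y_def add_pos_pos)
  have "m * y = (m * exp (- z)) * (1 + z)" by (simp add: y_def algebra_simps)
  also have "m * exp (- z) \<le> exp z * exp (- z)"
    using exp_lower_Taylor_quadratic[of z] z0 by (intro mult_right_mono) (auto simp: m_def)
  then have "(m * exp (- z)) * (1 + z) \<le> 1 * (1 + z)"
    using z0 by (intro mult_right_mono) (auto simp: exp_minus)
  finally have my: "m * y \<le> 1 + z" by simp
  then have "m * y \<le> m * 1" using m0 by linarith
  then have y1: "y \<le> 1" using m0 by simp
  \<comment> \<open>With \<open>y = (1 + z) / m\<close> the claim is \<open>\<delta>\<^sub>0 * (z + 2)\<^sup>2 \<le> \<delta> * z\<^sup>2\<close>.\<close>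
  have key: "\<delta>\<^sub>0 * (z\<^sup>2 + 4 * z + 4) \<le> \<delta> * z\<^sup>2"
  \<comment> \<open>The polynomial is at most 9 for \<open>z \<le> 1\<close> and at most
    \<open>9 * z\<^sup>2\<close> beyond. The threshold settles the first range,
    \<open>12 * \<delta>\<^sub>0 \<le> \<delta>\<close> the second.\<close>
  proof (cases "z \<le> 1")
    case True
    then have "z\<^sup>2 + 4 * z + 4 \<le> 12"
      using power_le_one[of z 2] z0 by simp
    then have "\<delta>\<^sub>0 * (z\<^sup>2 + 4 * z + 4) \<le> \<delta>\<^sub>0 * 12"
      using assms by (intro mult_left_mono) auto
    with z show ?thesis by linarith
  next
    case False
    then have "z \<le> z\<^sup>2" "1 \<le> z\<^sup>2" by (auto simp: power2_eq_square)
        (smt (verit) mult_le_cancel_left1)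
    then have "\<delta>\<^sub>0 * (z\<^sup>2 + 4 * z + 4) \<le> \<delta>\<^sub>0 * (12 * z\<^sup>2)"
      using assms by (intro mult_left_mono) auto
    also have "\<dots> \<le> \<delta> * z\<^sup>2" using mult_right_mono[OF assms(2), of "z\<^sup>2"] by simp
    finally show ?thesis .
  qed
  have "(\<delta> + \<delta>\<^sub>0) * (m * y) \<le> (\<delta> + \<delta>\<^sub>0) * (1 + z)"
    using my assms by (intro mult_left_mono) auto
  also have "\<dots> \<le> (\<delta> - \<delta>\<^sub>0) * m" using key by (simp add: m_def algebra_simps)
  finally have "m * ((\<delta> + \<delta>\<^sub>0) * y) \<le> m * (\<delta> - \<delta>\<^sub>0)" by (simp add: mult_ac)
  then have "(\<delta> + \<delta>\<^sub>0) * y \<le> \<delta> - \<delta>\<^sub>0" using m0 by simp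
  then show ?thesis
    unfolding y_def[symmetric] using assms y0 y1
    by (intro not_delta_cancellationI) (auto simp: algebra_simps)
qed

theorem theorem3p2:
  fixes \<alpha> \<delta>\<^sub>0 \<delta> \<theta> :: real and t :: "nat \<Rightarrow> real" and k j :: nat
  assumes "0 < \<alpha>" and "\<alpha> < 1"
    and "0 < \<delta>\<^sub>0" and "12 * \<delta>\<^sub>0 < \<delta>"
    and "2 \<le> k" and "strict_mono_on {0..k} t"
    and "1 \<le> j" and "j \<le> k - 1"
    and "0 < \<theta>"
  shows
    "(step t j / (t k - t (j - 1)) \<ge> theta_s1 \<alpha> \<delta>\<^sub>0 \<delta> \<longrightarrow>
        not_delta_cancellation \<delta>\<^sub>0 \<delta>
          ((t k - t (j - 1)) powr (1 - \<alpha>))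
          ((t k - t j) powr (1 - \<alpha>))) \<and>
     (step t j / (t k - t (j - 1)) \<ge> theta_s2 \<alpha> \<delta>\<^sub>0 \<delta> \<longrightarrow>
        not_delta_cancellation \<delta>\<^sub>0 \<delta>
          ((2 - \<alpha>) * step t j * (t k - t (j - 1)) powr (1 - \<alpha>) + (t k - t j) powr (2 - \<alpha>))
          ((t k - t (j - 1)) powr (2 - \<alpha>))) \<and>
     (\<theta> * step t (k - 1) \<ge> theta_f1 \<delta>\<^sub>0 \<delta> \<longrightarrow>
        not_delta_cancellation \<delta>\<^sub>0 \<delta>
          1
          (exp (- (\<theta> * step t (k - 1))))) \<and>
     (\<theta> * step t (k - 1) \<ge> theta_f2 \<delta>\<^sub>0 \<delta> \<longrightarrow>
        not_delta_cancellation \<delta>\<^sub>0 \<delta>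
          1
          (\<theta> * step t (k - 1) * exp (- (\<theta> * step t (k - 1))) + exp (- (\<theta> * step t (k - 1)))))"
proof -
  define T where "T = t k - t (j - 1)"
  \<comment> \<open>Since \<open>1 \<le> j\<close>, the truncated \<open>j - 1\<close> is the true
    predecessor, and \<open>j \<le> k - 1\<close> with \<open>2 \<le> k\<close> gives
    \<open>j < k\<close>. The latter makes \<open>step t j / T\<close> less than 1, which keeps the
    bases of the powers positive.\<close>
  have "t (j - 1) < t j" "t j < t k"
    using assms by (auto intro!: strict_mono_onD[OF \<open>strict_mono_on {0..k} t\<close>])
  then have T: "0 < T" "0 \<le> step t j" "step t j < T" "t k - t j = T - step t j"
    by (auto simp: T_def step_def)
  show ?thesis
    unfolding T(4) T_def[symmetric] using assms T
    by (intro conjI impI not_delta_cancellation_powr_diff not_delta_cancellation_powr_second_order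
        not_delta_cancellation_one_minus_exp not_delta_cancellation_one_minus_exp_second_order) auto
qed

end
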